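(* Let $F:\mathbb{R}^d\to\mathbb{R}$ be lower bounded by $F^*$ with $\Delta_1\ge F(x_1)-F^*$, $\Delta_1>0$, let $F$ be $L$-smooth with $L>0$, and let the gradient oracle satisfy the $p$-BCM assumption with $p\in(1,2]$ and constant $\sigma\ge0$. Then for every $T\ge1$ the iterates generated by minibatch-NSGD with parameters $\eta_t\equiv\sqrt{\frac{\Delta_1}{LT}}$ and $B_t\equiv\left\lceil\max\left\{1,\left(\frac{\sigma^2T}{\Delta_1L}\right)^{\frac{p}{2p-2}}\right\}\right\rceil$ satisfy $$\frac1T\sum_{t=1}^T\mathbb{E}\big[\|\nabla F(x_t)\|\big]\le 6\,\frac{\sqrt{\Delta_1L}}{\sqrt T}.$$ In particular, the sample complexity, i.e. the number of oracle calls sufficient (for a suitable $T$) to guarantee $\frac1T\sum_{t=1}^T\mathbb{E}[\|\nabla F(x_t)\|]\le\varepsilon$, is bounded by $$\mathcal{O}\left(\frac{\Delta_1L}{\varepsilon^2}+\frac{\Delta_1L}{\varepsilon^2}\Big(\frac{\sigma}{\varepsilon}\Big)^{\frac{p}{p-1}}\right).$$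
   Context: Assumptions. (Lower boundedness) $F\ge F^*>-\infty$ on $\mathbb{R}^d$, and $\Delta_1\ge F(x_1)-F^*$ is a given upper bound on the initialization gap. ($L$-smoothness) $F$ is differentiable and $\|\nabla F(x)-\nabla F(y)\|\le L\|x-y\|$ for all $x,y\in\mathbb{R}^d$. ($p$-BCM) for all $x\in\mathbb{R}^d$: $\mathbb{E}[\nabla f(x,\xi)]=\nabla F(x)$ and $\mathbb{E}[\|\nabla f(x,\xi)-\nabla F(x)\|^p]\le\sigma^p$, where $\nabla f(\cdot,\xi)$ is the stochastic gradient oracle. minibatch-NSGD: from a deterministic initial point $x_1$, iterate $x_{t+1}=x_t-\eta_t\, g_t/\|g_t\|$ with $g_t=\frac1{B_t}\sum_{j=1}^{B_t}\nabla f(x_t,\xi_t^{(j)})$, where all $\xi_t^{(j)}$ (over all $t$ and $j$) are independent copies of $\xi$. Convention: $g/\|g\|:=0$ if $g=0$. A run with horizon $T$ uses $\sum_{t=1}^TB_t$ oracle calls. The notation $\mathcal{O}(\cdot)$ means: at most $C$ times the displayed expression, with $C$ depending only on $p$, for all sufficiently small $\varepsilon>0$ (the threshold may depend on $\Delta_1,L,\sigma$). *)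

theory Defs
  imports "HOL-Probability.Probability"
begin

definition grad :: "('a::real_inner \<Rightarrow> real) \<Rightarrow> 'a \<Rightarrow> 'a" where
  "grad F x = (THE g. GDERIV F x :> g)"

definition L_smooth :: "real \<Rightarrow> ('a::euclidean_space \<Rightarrow> real) \<Rightarrow> bool" where
  "L_smooth L F \<longleftrightarrow>
     (\<forall>x. F differentiable (at x)) \<and>
     (\<forall>x y. norm (grad F x - grad F y) \<le> L * norm (x - y))"

text \<open>\<open>D\<close> is the law of the random variable \<open>\<xi>\<close> and \<open>G x s\<close> is the stochastic gradient at \<open>x\<close>
  for the realisation \<open>s\<close> of \<open>\<xi>\<close>. Joint measurability makes the iterates random variables. The
  integrability conditions are part of the assertion that the moments exist, since the Bochner
  integral of a non-integrable function is 0.\<close>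

definition p_BCM_oracle ::
  "real \<Rightarrow> real \<Rightarrow> ('a::euclidean_space \<Rightarrow> real) \<Rightarrow> 's measure \<Rightarrow> ('a \<Rightarrow> 's \<Rightarrow> 'a) \<Rightarrow> bool" where
  "p_BCM_oracle p \<sigma> F D G \<longleftrightarrow>
     prob_space D \<and>
     (\<lambda>(x, s). G x s) \<in> borel_measurable (borel \<Otimes>\<^sub>M D) \<and>
     (\<forall>x. integrable D (\<lambda>s. G x s) \<and>
          (\<integral>s. G x s \<partial>D) = grad F x \<and>
          integrable D (\<lambda>s. norm (G x s - grad F x) powr p) \<and>
          (\<integral>s. norm (G x s - grad F x) powr p \<partial>D) \<le> \<sigma> powr p)"

definition iid_samples ::
  "'w measure \<Rightarrow> 's measure \<Rightarrow> ('i \<Rightarrow> 'w \<Rightarrow> 's) \<Rightarrow> 'i set \<Rightarrow> bool" where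
  "iid_samples M D \<xi> I \<longleftrightarrow>
     prob_space M \<and>
     prob_space.indep_vars M (\<lambda>_. D) \<xi> I \<and>
     (\<forall>i\<in>I. distr M D (\<xi> i) = D)"

definition minibatch_grad ::
  "('a::euclidean_space \<Rightarrow> 's \<Rightarrow> 'a) \<Rightarrow> (nat \<times> nat \<Rightarrow> 'w \<Rightarrow> 's) \<Rightarrow> (nat \<Rightarrow> nat) \<Rightarrow> nat \<Rightarrow> 'a \<Rightarrow> 'w \<Rightarrow> 'a" where
  "minibatch_grad G \<xi> B t x \<omega> = (1 / real (B t)) *\<^sub>R (\<Sum>j=1..B t. G x (\<xi> (t, j) \<omega>))"

text \<open>Iterates are indexed from 1; index 0 is not used. The function \<^const>\<open>sgn\<close> on a normed
  space is \<open>g / \<parallel>g\<parallel>\<close>, with value 0 at 0.\<close>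

fun nsgd ::
  "('a::euclidean_space \<Rightarrow> 's \<Rightarrow> 'a) \<Rightarrow> (nat \<times> nat \<Rightarrow> 'w \<Rightarrow> 's) \<Rightarrow> (nat \<Rightarrow> real) \<Rightarrow> (nat \<Rightarrow> nat) \<Rightarrow> 'a
    \<Rightarrow> nat \<Rightarrow> 'w \<Rightarrow> 'a" where
  "nsgd G \<xi> \<eta> B x1 0 \<omega> = x1"
| "nsgd G \<xi> \<eta> B x1 (Suc 0) \<omega> = x1"
| "nsgd G \<xi> \<eta> B x1 (Suc (Suc t)) \<omega> =
     nsgd G \<xi> \<eta> B x1 (Suc t) \<omega> -
     \<eta> (Suc t) *\<^sub>R sgn (minibatch_grad G \<xi> B (Suc t) (nsgd G \<xi> \<eta> B x1 (Suc t) \<omega>) \<omega>)"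

text \<open>Only the samples drawn in a run with horizon \<open>T\<close> and batch sizes \<open>B\<close> are required
  to be independent copies of \<open>\<xi>\<close>.\<close>

definition nsgd_setting ::
  "real \<Rightarrow> real \<Rightarrow> real \<Rightarrow> real \<Rightarrow> nat \<Rightarrow> (nat \<Rightarrow> nat) \<Rightarrow> ('a::euclidean_space \<Rightarrow> real) \<Rightarrow> real \<Rightarrow> 'a
    \<Rightarrow> 's measure \<Rightarrow> ('a \<Rightarrow> 's \<Rightarrow> 'a) \<Rightarrow> 'w measure \<Rightarrow> (nat \<times> nat \<Rightarrow> 'w \<Rightarrow> 's) \<Rightarrow> bool" where
  "nsgd_setting p \<Delta>1 L \<sigma> T B F Fstar x1 D G M \<xi> \<longleftrightarrow>
     (\<forall>x. Fstar \<le> F x) \<and> F x1 - Fstar \<le> \<Delta>1 \<and>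
     L_smooth L F \<and>
     p_BCM_oracle p \<sigma> F D G \<and>
     iid_samples M D \<xi> (SIGMA t:{1..T}. {1..B t})"

definition avg_grad_norm ::
  "'w measure \<Rightarrow> ('a::euclidean_space \<Rightarrow> real) \<Rightarrow> (nat \<Rightarrow> 'w \<Rightarrow> 'a) \<Rightarrow> nat \<Rightarrow> real" where
  "avg_grad_norm M F X T = (1 / real T) * (\<Sum>t=1..T. \<integral>\<omega>. norm (grad F (X t \<omega>)) \<partial>M)"

definition step_size :: "real \<Rightarrow> real \<Rightarrow> nat \<Rightarrow> nat \<Rightarrow> real" where
  "step_size \<Delta>1 L T = (\<lambda>t. sqrt (\<Delta>1 / (L * real T)))"

definition batch_size :: "real \<Rightarrow> real \<Rightarrow> real \<Rightarrow> real \<Rightarrow> nat \<Rightarrow> nat \<Rightarrow> nat" where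
  "batch_size p \<Delta>1 L \<sigma> T =
     (\<lambda>t. nat \<lceil>max 1 ((\<sigma>\<^sup>2 * real T / (\<Delta>1 * L)) powr (p / (2 * p - 2)))\<rceil>)"

text \<open>A constant for the O-notation, depending only on \<open>p\<close>. An existentially quantified constant
  inside a theorem that is polymorphic in the dimension and in the sample spaces could depend
  on these types, so the constant is given as a closed term. The value comes from
  \<open>T = \<lceil>36 \<Delta>\<^sub>1 L / \<epsilon>\<^sup>2\<rceil>\<close>, which is at most \<open>37 \<Delta>\<^sub>1 L / \<epsilon>\<^sup>2\<close> for \<open>\<epsilon> \<le> sqrt (\<Delta>\<^sub>1 L)\<close>.\<close>

definition complexity_const :: "real \<Rightarrow> real" where
  "complexity_const p = 37 powr (1 + p / (2 * p - 2))"

end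

theory Submission
  imports Defs
begin

text \<open>By \<open>L\<close>-smoothness a step of length \<open>\<eta>\<close> along \<open>- g / \<parallel>g\<parallel>\<close> decreases \<open>F\<close> by at least
  \<open>\<eta> (\<parallel>\<nabla>F\<parallel> - 2 \<parallel>g - \<nabla>F\<parallel>) - L \<eta>\<^sup>2 / 2\<close>. Put \<open>\<tau> = sqrt (\<Delta>\<^sub>1 L / T)\<close>. The batch size is such that
  the \<open>p\<close>-th moments of the \<open>B\<close> centred stochastic gradients sum to at most \<open>(B \<tau>)\<^sup>p\<close>. Clipping
  these gradients at level \<open>B \<tau>\<close> shows that the minibatch error is at most \<open>17 \<tau> / 8\<close> in
  expectation, so telescoping bounds the average gradient norm by
  \<open>\<tau> + 2 (17 / 8) \<tau> + \<tau> / 2 \<le> 6 \<tau>\<close>.\<close>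

subsection \<open>Sums of independent vectors with finite \<open>p\<close>-th moments\<close>

text \<open>Nonnegativity of the variance of \<open>norm (X \<omega>)\<close>. The first moment
  exists because \<open>r <= 1 + r^2\<close>, which follows from \<open>(r - 1)^2 >= 0\<close> for
  \<open>r >= 0\<close>.\<close>

lemma (in prob_space) expectation_norm_le_sqrt:
  fixes X :: "'a \<Rightarrow> 'b::euclidean_space"
  assumes [measurable]: "X \<in> borel_measurable M"
    and sq: "integrable M (\<lambda>\<omega>. (norm (X \<omega>))\<^sup>2)"
  shows "expectation (\<lambda>\<omega>. norm (X \<omega>)) \<le> sqrt (expectation (\<lambda>\<omega>. (norm (X \<omega>))\<^sup>2))"
proof (rule real_le_rsqrt)
  have bound: "norm (X \<omega>) \<le> 1 + (norm (X \<omega>))\<^sup>2" for \<omega>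
    using zero_le_power2[of "norm (X \<omega>) - 1"] norm_ge_zero[of "X \<omega>"]
    by (simp add: power2_eq_square algebra_simps del: norm_ge_zero)
  have int: "integrable M (\<lambda>\<omega>. norm (X \<omega>))"
    by (rule Bochner_Integration.integrable_bound[where f="\<lambda>\<omega>. 1 + (norm (X \<omega>))\<^sup>2"])
      (use sq bound in auto)
  show "(expectation (\<lambda>\<omega>. norm (X \<omega>)))\<^sup>2 \<le> expectation (\<lambda>\<omega>. (norm (X \<omega>))\<^sup>2)"
    using variance_eq[OF int sq] variance_positive[of "\<lambda>\<omega>. norm (X \<omega>)"] by simp
qed

text \<open>The inner product is expanded over \<open>Basis\<close>; each pair of coordinates
  inherits independence, so the scalar product rule applies term by term.\<close>

lemma (in prob_space) expectation_inner_indep: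
  fixes X :: "'i \<Rightarrow> 'a \<Rightarrow> 'b::euclidean_space"
  assumes indep: "indep_vars (\<lambda>_. borel) X I" and ij: "i \<in> I" "j \<in> I" "i \<noteq> j"
    and int: "integrable M (X i)" "integrable M (X j)"
  shows "integrable M (\<lambda>\<omega>. X i \<omega> \<bullet> X j \<omega>)"
    and "expectation (\<lambda>\<omega>. X i \<omega> \<bullet> X j \<omega>) = expectation (X i) \<bullet> expectation (X j)"
proof -
  have iv: "indep_var borel (\<lambda>\<omega>. X i \<omega> \<bullet> b) borel (\<lambda>\<omega>. X j \<omega> \<bullet> b)" for b
  proof -
    \<comment> \<open>Restricting the family to \<open>{i}\<close> and \<open>{j}\<close> gives
      variables valued in product spaces; evaluation at the single index brings back the coordinates
      of \<open>X i\<close> and \<open>X j\<close>.\<close>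
    have m: "(\<lambda>f. f k \<bullet> b) \<in> borel_measurable (PiM {k} (\<lambda>_. borel))" for k :: 'i
      by measurable
    show ?thesis
      using indep_var_compose[OF indep_var_restrict[OF indep, of "{i}" "{j}"] m m] ij
      by (simp add: o_def)
  qed
  have ib: "integrable M (\<lambda>\<omega>. X i \<omega> \<bullet> b)" "integrable M (\<lambda>\<omega>. X j \<omega> \<bullet> b)" for b
    using int by auto
  have eq: "(\<lambda>\<omega>. X i \<omega> \<bullet> X j \<omega>) = (\<lambda>\<omega>. \<Sum>b\<in>Basis. (X i \<omega> \<bullet> b) * (X j \<omega> \<bullet> b))"
    by (rule ext) (rule euclidean_inner)
  have prod: "integrable M (\<lambda>\<omega>. (X i \<omega> \<bullet> b) * (X j \<omega> \<bullet> b))" for b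
    by (rule indep_var_integrable[OF iv ib])
  show "integrable M (\<lambda>\<omega>. X i \<omega> \<bullet> X j \<omega>)"
    unfolding eq using prod by auto
  have "expectation (\<lambda>\<omega>. X i \<omega> \<bullet> X j \<omega>)
      = (\<Sum>b\<in>Basis. expectation (\<lambda>\<omega>. X i \<omega> \<bullet> b) * expectation (\<lambda>\<omega>. X j \<omega> \<bullet> b))"
    unfolding eq using prod by (simp add: indep_var_lebesgue_integral[OF iv ib])
  also have "\<dots> = expectation (X i) \<bullet> expectation (X j)"
    unfolding euclidean_inner[of "expectation (X i)" "expectation (X j)"] using int by simp
  finally show "expectation (\<lambda>\<omega>. X i \<omega> \<bullet> X j \<omega>) = expectation (X i) \<bullet> expectation (X j)" .
qed

text \<open>Pythagoras in mean square: in the double sum of inner products, independence and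
  centring annihilate everything off the diagonal.\<close>

lemma (in prob_space) expectation_norm_sum_squared:
  fixes X :: "'i \<Rightarrow> 'a \<Rightarrow> 'b::euclidean_space"
  assumes fin: "finite I" and indep: "indep_vars (\<lambda>_. borel) X I"
    and int: "\<And>i. i \<in> I \<Longrightarrow> integrable M (X i)"
    and mean: "\<And>i. i \<in> I \<Longrightarrow> expectation (X i) = 0"
    and sq: "\<And>i. i \<in> I \<Longrightarrow> integrable M (\<lambda>\<omega>. (norm (X i \<omega>))\<^sup>2)"
  shows "integrable M (\<lambda>\<omega>. (norm (\<Sum>i\<in>I. X i \<omega>))\<^sup>2)"
    and "expectation (\<lambda>\<omega>. (norm (\<Sum>i\<in>I. X i \<omega>))\<^sup>2)
      = (\<Sum>i\<in>I. expectation (\<lambda>\<omega>. (norm (X i \<omega>))\<^sup>2))"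
proof -
  have eq: "(\<lambda>\<omega>. (norm (\<Sum>i\<in>I. X i \<omega>))\<^sup>2) = (\<lambda>\<omega>. \<Sum>i\<in>I. \<Sum>j\<in>I. X i \<omega> \<bullet> X j \<omega>)"
    by (simp add: power2_norm_eq_inner inner_sum_left inner_sum_right) (intro ext sum.swap)
  have prod: "integrable M (\<lambda>\<omega>. X i \<omega> \<bullet> X j \<omega>)" if "i \<in> I" "j \<in> I" for i j
    using expectation_inner_indep(1)[OF indep that _ int int] sq[of i] that
    by (cases "i = j") (auto simp: power2_norm_eq_inner)
  have val: "expectation (\<lambda>\<omega>. X i \<omega> \<bullet> X j \<omega>) =
      (if j = i then expectation (\<lambda>\<omega>. (norm (X i \<omega>))\<^sup>2) else 0)" if "i \<in> I" "j \<in> I" for i j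
    using expectation_inner_indep(2)[OF indep that _ int int] mean that
    by (cases "i = j") (auto simp: power2_norm_eq_inner)
  show "integrable M (\<lambda>\<omega>. (norm (\<Sum>i\<in>I. X i \<omega>))\<^sup>2)"
    unfolding eq using prod by auto
  show "expectation (\<lambda>\<omega>. (norm (\<Sum>i\<in>I. X i \<omega>))\<^sup>2)
      = (\<Sum>i\<in>I. expectation (\<lambda>\<omega>. (norm (X i \<omega>))\<^sup>2))"
    unfolding eq using prod fin by (simp add: val)
qed

text \<open>For \<open>R > 0\<close> this is the metric projection onto the closed ball of radius
  \<open>R\<close> around 0. At \<open>x = 0\<close> the quotient is 0 by convention, which is
  harmless since the factor multiplies 0.\<close>

definition clip :: "real \<Rightarrow> 'a::euclidean_space \<Rightarrow> 'a" where
  "clip R x = min 1 (R / norm x) *\<^sub>R x"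

lemma borel_measurable_clip [measurable]: "clip R \<in> borel_measurable borel"
  unfolding clip_def by measurable

lemma norm_clip: "0 < R \<Longrightarrow> norm (clip R x) = min (norm x) R"
  by (cases "x = 0") (auto simp: clip_def min_def field_simps)

lemma norm_diff_clip: "0 < R \<Longrightarrow> norm (x - clip R x) = norm x - min (norm x) R"
proof -
  assume R: "0 < R"
  have "x - clip R x = (1 - min 1 (R / norm x)) *\<^sub>R x"
    by (simp add: clip_def algebra_simps)
  then show ?thesis
    using R by (cases "x = 0") (auto simp: min_def left_diff_distrib divide_le_eq le_divide_eq)
qed

text \<open>In terms of \<open>u = x / R\<close> the left side is \<open>u^2\<close> for
  \<open>u <= 1\<close> and \<open>1 + (u - 1) = u\<close> beyond. Both are at most
  \<open>u powr p\<close> because \<open>p\<close> lies between 1 and 2.\<close>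

lemma truncation_le_powr:
  fixes p R x :: real
  assumes "1 \<le> p" "p \<le> 2" "0 < R" "0 \<le> x"
  shows "(min x R)\<^sup>2 / R\<^sup>2 + (x - min x R) / R \<le> x powr p / R powr p"
proof -
  define u where "u = x / R"
  have u: "0 \<le> u" "x = u * R" using assms by (auto simp: u_def)
  have "(min u 1)\<^sup>2 + (u - min u 1) \<le> u powr p"
  proof (cases "u \<le> 1")
    case True
    then show ?thesis
      using powr_mono'[of p 2 u] assms u(1) by (cases "u = 0") auto
  next
    case False
    then show ?thesis using powr_mono[of 1 p u] assms by auto
  qed
  moreover have "min x R = min u 1 * R"
    using assms by (auto simp: u(2) min_def)
  ultimately show ?thesis
    using assms u by (simp add: powr_mult power_mult_distrib left_diff_distrib[symmetric])
qed

text \<open>Clipping at level \<open>R\<close> splits each summand into a part with a second moment, for which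
  independence gives orthogonality, and a tail with a small first moment. With \<open>s\<^sup>2\<close> and \<open>1 - s\<^sup>2\<close>
  the shares of the \<open>p\<close>-th moments spent on the two parts, the constant is the maximum of
  \<open>s + 2 (1 - s\<^sup>2)\<close>, attained at \<open>s = 1 / 4\<close>.\<close>

lemma (in prob_space) expectation_norm_sum_le:
  fixes X :: "'i \<Rightarrow> 'a \<Rightarrow> 'b::euclidean_space"
  assumes fin: "finite I" and indep: "indep_vars (\<lambda>_. borel) X I"
    and p: "1 \<le> p" "p \<le> 2" and R: "0 < R"
    and int: "\<And>i. i \<in> I \<Longrightarrow> integrable M (X i)"
    and mean: "\<And>i. i \<in> I \<Longrightarrow> expectation (X i) = 0"
    and intp: "\<And>i. i \<in> I \<Longrightarrow> integrable M (\<lambda>\<omega>. norm (X i \<omega>) powr p)"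
    and mom: "(\<Sum>i\<in>I. expectation (\<lambda>\<omega>. norm (X i \<omega>) powr p)) \<le> R powr p"
  shows "expectation (\<lambda>\<omega>. norm (\<Sum>i\<in>I. X i \<omega>)) \<le> 17 / 8 * R"
proof -
  \<comment> \<open>The decomposition is \<open>X i = W i + V i + m i\<close>: centred clipped part,
    tail, and clipping bias. The numbers \<open>a i\<close> and \<open>z i\<close> measure the
    clipped part in second moment and the tail in first moment.\<close>
  define Y where "Y = (\<lambda>i \<omega>. clip R (X i \<omega>))"
  define m where "m i = expectation (Y i)" for i
  define W where "W = (\<lambda>i \<omega>. Y i \<omega> - m i)"
  define V where "V = (\<lambda>i \<omega>. X i \<omega> - Y i \<omega>)"
  define a where "a i = expectation (\<lambda>\<omega>. (norm (Y i \<omega>))\<^sup>2)" for i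
  define z where "z i = expectation (\<lambda>\<omega>. norm (V i \<omega>))" for i
  have X[measurable]: "X i \<in> borel_measurable M" if "i \<in> I" for i
    using int that by auto
  have Y_bd: "norm (Y i \<omega>) \<le> R" for i \<omega>
    using R by (simp add: Y_def norm_clip)
  have Y_meas[measurable]: "Y i \<in> borel_measurable M" if "i \<in> I" for i
    unfolding Y_def using that by measurable
  have intY: "integrable M (Y i)" if "i \<in> I" for i
    using that Y_bd by (intro integrable_const_bound[where B=R]) auto
  have intY2: "integrable M (\<lambda>\<omega>. (norm (Y i \<omega>))\<^sup>2)" if "i \<in> I" for i
    using that Y_bd by (intro integrable_const_bound[where B="R\<^sup>2"]) (auto intro!: power_mono)
  have intV: "integrable M (V i)" if "i \<in> I" for i
    unfolding V_def using that int intY by auto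
  have W_sq: "(norm (W i \<omega>))\<^sup>2 = (norm (Y i \<omega>))\<^sup>2 - 2 * (Y i \<omega> \<bullet> m i) + (norm (m i))\<^sup>2" for i \<omega>
    by (simp add: W_def power2_norm_eq_inner inner_diff_left inner_diff_right inner_commute)
  have intW: "integrable M (W i)" "integrable M (\<lambda>\<omega>. (norm (W i \<omega>))\<^sup>2)" if "i \<in> I" for i
    unfolding W_sq using intY intY2 that by (auto simp: W_def)
  have meanW: "expectation (W i) = 0" if "i \<in> I" for i
    using intY that by (simp add: W_def m_def prob_space)
  \<comment> \<open>A variance is at most the second moment.\<close>
  have W_le: "expectation (\<lambda>\<omega>. (norm (W i \<omega>))\<^sup>2) \<le> a i" if "i \<in> I" for i
    unfolding W_sq using intY intY2 that
    by (simp add: a_def m_def[symmetric] prob_space power2_norm_eq_inner[symmetric])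
  have indepW: "indep_vars (\<lambda>_. borel) W I"
    unfolding W_def Y_def
    by (rule indep_vars_compose2[OF indep]) measurable
  have meas_sumW: "(\<lambda>\<omega>. \<Sum>i\<in>I. W i \<omega>) \<in> borel_measurable M"
    by (rule borel_measurable_sum) (use intW in auto)
  have "expectation (\<lambda>\<omega>. norm (\<Sum>i\<in>I. W i \<omega>))
      \<le> sqrt (expectation (\<lambda>\<omega>. (norm (\<Sum>i\<in>I. W i \<omega>))\<^sup>2))"
    by (rule expectation_norm_le_sqrt[OF meas_sumW
          expectation_norm_sum_squared(1)[OF fin indepW intW(1) meanW intW(2)]])
  also have "\<dots> = sqrt (\<Sum>i\<in>I. expectation (\<lambda>\<omega>. (norm (W i \<omega>))\<^sup>2))"
    using expectation_norm_sum_squared(2)[OF fin indepW intW(1) meanW intW(2)] by simp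
  also have "\<dots> \<le> sqrt (\<Sum>i\<in>I. a i)"
    by (intro real_sqrt_le_mono sum_mono W_le)
  finally have W_bd: "expectation (\<lambda>\<omega>. norm (\<Sum>i\<in>I. W i \<omega>)) \<le> sqrt (\<Sum>i\<in>I. a i)" .
  \<comment> \<open>Since \<open>X i\<close> is centred, the bias of the clipped part is minus the
    mean of the tail.\<close>
  have m_le: "norm (m i) \<le> z i" if "i \<in> I" for i
  proof -
    have "expectation (V i) = - m i"
      using that int intY mean by (simp add: V_def m_def)
    then show ?thesis
      using integral_norm_bound[of M "V i"] by (simp add: z_def)
  qed
  have split: "norm (\<Sum>i\<in>I. X i \<omega>) \<le> norm (\<Sum>i\<in>I. W i \<omega>) + (\<Sum>i\<in>I. norm (V i \<omega>) + z i)" for \<omega>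
  proof -
    have "(\<Sum>i\<in>I. X i \<omega>) = (\<Sum>i\<in>I. W i \<omega>) + (\<Sum>i\<in>I. V i \<omega> + m i)"
      unfolding sum.distrib[symmetric] by (simp add: W_def V_def)
    then have "norm (\<Sum>i\<in>I. X i \<omega>) \<le> norm (\<Sum>i\<in>I. W i \<omega>) + norm (\<Sum>i\<in>I. V i \<omega> + m i)"
      by (metis norm_triangle_ineq)
    also have "norm (\<Sum>i\<in>I. V i \<omega> + m i) \<le> (\<Sum>i\<in>I. norm (V i \<omega>) + z i)"
      by (rule sum_norm_le) (meson add_mono m_le norm_triangle_ineq order_refl order_trans)
    finally show ?thesis by simp
  qed
  have int_sumW: "integrable M (\<lambda>\<omega>. norm (\<Sum>i\<in>I. W i \<omega>))"
    by (intro integrable_norm Bochner_Integration.integrable_sum intW)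
  have "expectation (\<lambda>\<omega>. norm (\<Sum>i\<in>I. X i \<omega>))
      \<le> expectation (\<lambda>\<omega>. norm (\<Sum>i\<in>I. W i \<omega>) + (\<Sum>i\<in>I. norm (V i \<omega>) + z i))"
  proof (rule integral_mono[OF _ _ split])
    show "integrable M (\<lambda>\<omega>. norm (\<Sum>i\<in>I. X i \<omega>))"
      by (intro integrable_norm Bochner_Integration.integrable_sum int)
    show "integrable M (\<lambda>\<omega>. norm (\<Sum>i\<in>I. W i \<omega>) + (\<Sum>i\<in>I. norm (V i \<omega>) + z i))"
      using intV by (intro Bochner_Integration.integrable_add[OF int_sumW]) auto
  qed
  \<comment> \<open>The factor 2 arises because the tail is paid for twice: directly through
    \<open>V i\<close>, and through the bias bounded by \<open>z i\<close>.\<close>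
  also have "\<dots> = expectation (\<lambda>\<omega>. norm (\<Sum>i\<in>I. W i \<omega>)) + 2 * (\<Sum>i\<in>I. z i)"
    using int_sumW intV by (simp add: z_def prob_space sum.distrib)
  also have "\<dots> \<le> sqrt (\<Sum>i\<in>I. a i) + 2 * (\<Sum>i\<in>I. z i)"
    using W_bd by simp
  finally have main: "expectation (\<lambda>\<omega>. norm (\<Sum>i\<in>I. X i \<omega>))
      \<le> sqrt (\<Sum>i\<in>I. a i) + 2 * (\<Sum>i\<in>I. z i)" .
  have az: "a i / R\<^sup>2 + z i / R \<le> expectation (\<lambda>\<omega>. norm (X i \<omega>) powr p) / R powr p"
    if i: "i \<in> I" for i
  proof -
    have "a i / R\<^sup>2 + z i / R = expectation (\<lambda>\<omega>. (norm (Y i \<omega>))\<^sup>2 / R\<^sup>2 + norm (V i \<omega>) / R)"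
      using intY2[OF i] intV[OF i] by (simp add: a_def z_def)
    also have "\<dots> \<le> expectation (\<lambda>\<omega>. norm (X i \<omega>) powr p / R powr p)"
    proof (rule integral_mono)
      show "(norm (Y i \<omega>))\<^sup>2 / R\<^sup>2 + norm (V i \<omega>) / R \<le> norm (X i \<omega>) powr p / R powr p" for \<omega>
        using truncation_le_powr[OF p R norm_ge_zero[of "X i \<omega>"]]
        by (simp add: Y_def V_def norm_clip[OF R] norm_diff_clip[OF R])
    qed (use intY2[OF i] intV[OF i] intp[OF i] in auto)
    finally show ?thesis by simp
  qed
  have "(\<Sum>i\<in>I. a i) / R\<^sup>2 + (\<Sum>i\<in>I. z i) / R
      \<le> (\<Sum>i\<in>I. expectation (\<lambda>\<omega>. norm (X i \<omega>) powr p)) / R powr p"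
    unfolding sum_divide_distrib sum.distrib[symmetric] by (rule sum_mono) (rule az)
  also have "\<dots> \<le> 1"
    using mom R by simp
  finally have le1: "(\<Sum>i\<in>I. a i) / R\<^sup>2 + (\<Sum>i\<in>I. z i) / R \<le> 1" .
  define s where "s = sqrt (\<Sum>i\<in>I. a i) / R"
  have "0 \<le> (\<Sum>i\<in>I. a i)" unfolding a_def by (intro sum_nonneg) auto
  then have "s\<^sup>2 = (\<Sum>i\<in>I. a i) / R\<^sup>2" by (simp add: s_def power_divide)
  then have "s + 2 * ((\<Sum>i\<in>I. z i) / R) \<le> s + 2 * (1 - s\<^sup>2)" using le1 by simp
  \<comment> \<open>The gap between the two sides is \<open>2 * (s - 1/4)^2\<close>.\<close>
  also have "\<dots> \<le> 17 / 8"
    using zero_le_power2[of "s - 1/4"] by (simp add: power2_eq_square algebra_simps)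
  finally have "(s + 2 * ((\<Sum>i\<in>I. z i) / R)) * R \<le> 17 / 8 * R"
    using R by (intro mult_right_mono) auto
  also have "(s + 2 * ((\<Sum>i\<in>I. z i) / R)) * R = sqrt (\<Sum>i\<in>I. a i) + 2 * (\<Sum>i\<in>I. z i)"
    using R by (simp add: s_def field_simps)
  finally show ?thesis using main by simp
qed

subsection \<open>Smooth functions and normalized steps\<close>

text \<open>Justifies the definite description in \<open>grad\<close>: the two linear forms agree,
  and comparing them at \<open>D - E\<close> gives \<open>D = E\<close>.\<close>

lemma GDERIV_unique:
  fixes F :: "'a::real_inner \<Rightarrow> real"
  assumes "GDERIV F x :> D" "GDERIV F x :> E"
  shows "D = E"
proof -
  have "(\<lambda>h. h \<bullet> D) = (\<lambda>h. h \<bullet> E)"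
    using assms unfolding gderiv_def by (rule has_derivative_unique)
  then have "(D - E) \<bullet> D = (D - E) \<bullet> E" by (rule fun_cong)
  then have "(D - E) \<bullet> (D - E) = 0" by (simp only: inner_diff_right)
  then show ?thesis by simp
qed

text \<open>Riesz representation in coordinates: the gradient is the vector whose component along
  \<open>b\<close> is \<open>f' b\<close>.\<close>

lemma GDERIV_grad:
  fixes F :: "'a::euclidean_space \<Rightarrow> real"
  assumes "F differentiable (at x)"
  shows "GDERIV F x :> grad F x"
proof -
  obtain f' where f': "(F has_derivative f') (at x)"
    using assms by (auto simp: differentiable_def)
  then interpret f': bounded_linear f' by (rule has_derivative_bounded_linear)
  have "f' h = h \<bullet> (\<Sum>b\<in>Basis. f' b *\<^sub>R b)" for h
  proof -
    have "f' h = f' (\<Sum>b\<in>Basis. (h \<bullet> b) *\<^sub>R b)" by (simp add: euclidean_representation)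
    also have "\<dots> = (\<Sum>b\<in>Basis. (h \<bullet> b) * f' b)" by (simp add: f'.sum f'.scaleR)
    finally show ?thesis by (simp add: inner_sum_right mult.commute)
  qed
  then have "f' = (\<lambda>h. h \<bullet> (\<Sum>b\<in>Basis. f' b *\<^sub>R b))" by blast
  then have D: "GDERIV F x :> (\<Sum>b\<in>Basis. f' b *\<^sub>R b)"
    using f' by (simp add: gderiv_def)
  then show ?thesis
    unfolding grad_def by (rule theI) (rule GDERIV_unique[OF _ D])
qed

lemma L_smooth_continuous_on:
  assumes "L_smooth L F"
  shows "continuous_on S F"
  using assms unfolding L_smooth_def
  by (intro continuous_at_imp_continuous_on ballI differentiable_imp_continuous_within) auto

lemma L_smooth_continuous_on_grad:
  assumes "L_smooth L F"
  shows "continuous_on S (grad F)"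
proof -
  \<comment> \<open>\<open>lipschitz_on\<close> demands a nonnegative constant, and the sign of
    \<open>L\<close> is open here, hence the absolute value.\<close>
  have "norm (grad F x - grad F y) \<le> \<bar>L\<bar> * norm (x - y)" for x y
    using assms mult_right_mono[OF abs_ge_self[of L] norm_ge_zero[of "x - y"]]
    unfolding L_smooth_def by (meson order_trans)
  then have "\<bar>L\<bar>-lipschitz_on S (grad F)"
    by (intro lipschitz_onI) (auto simp: dist_norm)
  then show ?thesis by (rule lipschitz_on_continuous_on)
qed

lemma L_smooth_descent:
  fixes F :: "'a::euclidean_space \<Rightarrow> real"
  assumes "L_smooth L F"
  shows "F (x + d) \<le> F x + grad F x \<bullet> d + L / 2 * (norm d)\<^sup>2"
proof -
  define \<phi> where "\<phi> s = F (x + s *\<^sub>R d) - s * (grad F x \<bullet> d) - L / 2 * s\<^sup>2 * (norm d)\<^sup>2" for s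
  have F: "(F has_derivative (\<lambda>h. h \<bullet> grad F y)) (at y)" for y
    using GDERIV_grad[of F y] assms by (auto simp: L_smooth_def gderiv_def)
  have D: "(\<phi> has_real_derivative (grad F (x + s *\<^sub>R d) - grad F x) \<bullet> d - L * s * (norm d)\<^sup>2) (at s)" for s
  proof -
    have "((\<lambda>s. F (x + s *\<^sub>R d)) has_derivative (\<lambda>h. (h *\<^sub>R d) \<bullet> grad F (x + s *\<^sub>R d))) (at s)"
      by (rule has_derivative_compose[OF _ F]) (auto intro!: derivative_eq_intros)
    then have "((\<lambda>s. F (x + s *\<^sub>R d)) has_real_derivative grad F (x + s *\<^sub>R d) \<bullet> d) (at s)"
      unfolding has_field_derivative_def
      by (rule has_derivative_eq_rhs) (auto simp: inner_commute mult.commute)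
    then show ?thesis
      unfolding \<phi>_def
      by (auto intro!: derivative_eq_intros simp: inner_diff_left)
  qed
  have "(grad F (x + s *\<^sub>R d) - grad F x) \<bullet> d - L * s * (norm d)\<^sup>2 \<le> 0" if "0 \<le> s" for s
  proof -
    have "(grad F (x + s *\<^sub>R d) - grad F x) \<bullet> d \<le> norm (grad F (x + s *\<^sub>R d) - grad F x) * norm d"
      by (rule norm_cauchy_schwarz)
    also have "\<dots> \<le> L * norm (x + s *\<^sub>R d - x) * norm d"
      using assms unfolding L_smooth_def by (intro mult_right_mono norm_ge_zero) blast
    finally show ?thesis using that by (simp add: power2_eq_square mult.assoc)
  qed
  then have "\<exists>y. (\<phi> has_real_derivative y) (at s) \<and> y \<le> 0" if "0 \<le> s" for s
    using D that by (intro exI conjI) auto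
  then have "\<phi> 1 \<le> \<phi> 0"
    using zero_le_one by (intro DERIV_nonpos_imp_nonincreasing[of 0 1 \<phi>])
  then show ?thesis by (simp add: \<phi>_def)
qed

text \<open>For \<open>v = g\<close> the product is exactly \<open>norm g\<close>. Passing from
  \<open>g\<close> to \<open>v\<close> costs \<open>norm (g - v)\<close> twice: once in the inner
  product and once in comparing the norms.\<close>

lemma inner_sgn_ge:
  fixes v g :: "'a::real_inner"
  shows "norm v - 2 * norm (g - v) \<le> v \<bullet> sgn g"
proof -
  have "g \<bullet> sgn g = norm g"
    by (cases "g = 0") (auto simp: sgn_div_norm dot_square_norm power2_eq_square)
  moreover have "(g - v) \<bullet> sgn g \<le> norm (g - v)"
    using norm_cauchy_schwarz[of "g - v" "sgn g"]
    by (cases "g = 0") (auto simp: norm_sgn)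
  moreover have "norm v \<le> norm g + norm (g - v)"
    using norm_triangle_ineq4[of g "g - v"] by simp
  ultimately show ?thesis by (simp add: inner_diff_left)
qed

text \<open>The descent inequality for \<open>d = - h *\<^sub>R sgn g\<close>. The length of
  \<open>d\<close> is \<open>h\<close>, or 0 if \<open>g = 0\<close>, so the bound on the quadratic
  term covers both cases.\<close>

lemma normalized_step_descent:
  fixes F :: "'a::euclidean_space \<Rightarrow> real"
  assumes "L_smooth L F" "0 \<le> L" "0 \<le> h"
  shows "h * norm (grad F x) \<le> F x - F (x - h *\<^sub>R sgn g) + 2 * h * norm (g - grad F x) + L / 2 * h\<^sup>2"
proof -
  have "F (x - h *\<^sub>R sgn g) \<le> F x - h * (grad F x \<bullet> sgn g) + L / 2 * (norm (h *\<^sub>R sgn g))\<^sup>2"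
    using L_smooth_descent[OF assms(1), of x "- (h *\<^sub>R sgn g)"] by simp
  moreover have "(norm (h *\<^sub>R sgn g))\<^sup>2 \<le> h\<^sup>2"
    by (simp add: norm_sgn)
  then have "L / 2 * (norm (h *\<^sub>R sgn g))\<^sup>2 \<le> L / 2 * h\<^sup>2"
    using assms by (intro mult_left_mono) auto
  moreover have "h * (norm (grad F x) - 2 * norm (g - grad F x)) \<le> h * (grad F x \<bullet> sgn g)"
    using assms inner_sgn_ge by (intro mult_left_mono)
  ultimately show ?thesis by (simp add: algebra_simps)
qed

subsection \<open>Iterates of the algorithm\<close>

lemma nsgd_Suc:
  assumes "1 \<le> t"
  shows "nsgd G \<xi> \<eta> B x1 (Suc t) \<omega> =
     nsgd G \<xi> \<eta> B x1 t \<omega> - \<eta> t *\<^sub>R sgn (minibatch_grad G \<xi> B t (nsgd G \<xi> \<eta> B x1 t \<omega>) \<omega>)"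
  using assms by (cases t) auto

lemma minibatch_grad_cong:
  assumes "\<And>j. 1 \<le> j \<Longrightarrow> j \<le> B t \<Longrightarrow> \<xi> (t, j) \<omega> = \<xi>' (t, j) \<omega>'"
  shows "minibatch_grad G \<xi> B t x \<omega> = minibatch_grad G \<xi>' B t x \<omega>'"
  using assms by (auto simp: minibatch_grad_def intro!: sum.cong)

text \<open>Adaptedness: iterate \<open>t\<close> is determined by the samples of the rounds before
  \<open>t\<close>. The two runs may live on different sample spaces, which later permits replacing
  \<open>\<omega>\<close> by the tuple of past samples.\<close>

lemma nsgd_cong:
  assumes "\<And>s j. 1 \<le> s \<Longrightarrow> s < t \<Longrightarrow> 1 \<le> j \<Longrightarrow> j \<le> B s \<Longrightarrow> \<xi> (s, j) \<omega> = \<xi>' (s, j) \<omega>'"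
  shows "nsgd G \<xi> \<eta> B x1 t \<omega> = nsgd G \<xi>' \<eta> B x1 t \<omega>'"
  using assms
proof (induction t)
  case (Suc t)
  show ?case
  proof (cases "1 \<le> t")
    case True
    have "minibatch_grad G \<xi> B t x \<omega> = minibatch_grad G \<xi>' B t x \<omega>'" for x
      using Suc.prems True by (intro minibatch_grad_cong) auto
    then show ?thesis using True Suc by (simp add: nsgd_Suc)
  qed (auto simp: not_le)
qed simp

text \<open>The map \<open>Z\<close> lets the samples be read from one component of a product space
  while the query point \<open>X\<close> depends on the other.\<close>

lemma borel_measurable_minibatch_grad:
  fixes G :: "'a::euclidean_space \<Rightarrow> 's \<Rightarrow> 'a"
  assumes G: "(\<lambda>(x, s). G x s) \<in> borel_measurable (borel \<Otimes>\<^sub>M D)"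
    and \<xi>: "\<And>j. 1 \<le> j \<Longrightarrow> j \<le> B t \<Longrightarrow> (\<lambda>\<omega>. \<xi> (t, j) (Z \<omega>)) \<in> measurable N D"
    and X: "X \<in> borel_measurable N"
  shows "(\<lambda>\<omega>. minibatch_grad G \<xi> B t (X \<omega>) (Z \<omega>)) \<in> borel_measurable N"
proof -
  have "(\<lambda>\<omega>. G (X \<omega>) (\<xi> (t, j) (Z \<omega>))) \<in> borel_measurable N" if "j \<in> {1..B t}" for j
    using measurable_compose[OF measurable_Pair[OF X \<xi>] G, of j] that by simp
  then show ?thesis
    unfolding minibatch_grad_def by measurable
qed

lemma borel_measurable_nsgd:
  fixes G :: "'a::euclidean_space \<Rightarrow> 's \<Rightarrow> 'a"
  assumes G: "(\<lambda>(x, s). G x s) \<in> borel_measurable (borel \<Otimes>\<^sub>M D)"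
    and "\<And>s j. 1 \<le> s \<Longrightarrow> s < t \<Longrightarrow> 1 \<le> j \<Longrightarrow> j \<le> B s \<Longrightarrow> \<xi> (s, j) \<in> measurable N D"
  shows "nsgd G \<xi> \<eta> B x1 t \<in> borel_measurable N"
  using assms(2)
proof (induction t)
  case 0
  then show ?case by (simp cong: measurable_cong)
next
  case (Suc t)
  show ?case
  proof (cases "1 \<le> t")
    case True
    have X: "nsgd G \<xi> \<eta> B x1 t \<in> borel_measurable N"
      using Suc by auto
    have "(\<lambda>\<omega>. minibatch_grad G \<xi> B t (nsgd G \<xi> \<eta> B x1 t \<omega>) \<omega>) \<in> borel_measurable N"
      using Suc.prems True
      by (intro borel_measurable_minibatch_grad[OF G _ X, where Z="\<lambda>\<omega>. \<omega>"]) auto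
    then have "(\<lambda>\<omega>. nsgd G \<xi> \<eta> B x1 t \<omega> - \<eta> t *\<^sub>R
        sgn (minibatch_grad G \<xi> B t (nsgd G \<xi> \<eta> B x1 t \<omega>) \<omega>)) \<in> borel_measurable N"
      unfolding sgn_div_norm using X by measurable
    then show ?thesis using True by (simp add: nsgd_Suc cong: measurable_cong)
  next
    case False
    then show ?thesis by (simp add: not_le cong: measurable_cong)
  qed
qed

text \<open>A normalized step has length at most the absolute step size, whatever the oracle
  returns, so the bound is uniform in \<open>\<omega>\<close>.\<close>

lemma nsgd_bounded:
  "\<exists>K. \<forall>\<omega>. norm (nsgd G \<xi> \<eta> B x1 t \<omega> - x1) \<le> K"
proof (induction t)
  case (Suc t)
  then obtain K where K: "norm (nsgd G \<xi> \<eta> B x1 t \<omega> - x1) \<le> K" for \<omega> by blast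
  show ?case
  proof (cases "1 \<le> t")
    case True
    have "norm (nsgd G \<xi> \<eta> B x1 (Suc t) \<omega> - x1) \<le> K + \<bar>\<eta> t\<bar>" for \<omega>
    proof -
      let ?v = "\<eta> t *\<^sub>R sgn (minibatch_grad G \<xi> B t (nsgd G \<xi> \<eta> B x1 t \<omega>) \<omega>)"
      have "norm (nsgd G \<xi> \<eta> B x1 (Suc t) \<omega> - x1) = norm ((nsgd G \<xi> \<eta> B x1 t \<omega> - x1) - ?v)"
        using True by (simp add: nsgd_Suc algebra_simps)
      also have "\<dots> \<le> K + norm ?v"
        using norm_triangle_ineq4 K by (meson add_mono order_refl order_trans)
      also have "norm ?v \<le> \<bar>\<eta> t\<bar>" by (simp add: norm_sgn)
      finally show ?thesis by simp
    qed
    then show ?thesis by blast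
  qed (auto simp: not_le)
qed auto

text \<open>The iterate stays in a fixed compact ball, on which a continuous function is
  bounded.\<close>

lemma (in prob_space) integrable_continuous_nsgd:
  fixes \<phi> :: "'b::euclidean_space \<Rightarrow> real"
  assumes "nsgd G \<xi> \<eta> B x1 t \<in> borel_measurable M" and cont: "continuous_on UNIV \<phi>"
  shows "integrable M (\<lambda>\<omega>. \<phi> (nsgd G \<xi> \<eta> B x1 t \<omega>))"
proof -
  obtain K where K: "nsgd G \<xi> \<eta> B x1 t \<omega> \<in> cball x1 K" for \<omega>
    using nsgd_bounded[of G \<xi> \<eta> B x1 t] by (auto simp: dist_norm norm_minus_commute)
  have "compact (\<phi> ` cball x1 K)"
    using cont by (intro compact_continuous_image compact_cball) (auto intro: continuous_on_subset)
  then obtain C where "norm (\<phi> y) \<le> C" if "y \<in> cball x1 K" for y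
    by (meson compact_imp_bounded bounded_iff imageI)
  then have "norm (\<phi> (nsgd G \<xi> \<eta> B x1 t \<omega>)) \<le> C" for \<omega>
    using K by blast
  then show ?thesis
    using measurable_compose[OF assms(1) borel_measurable_continuous_onI[OF cont]]
    by (intro integrable_const_bound[where B=C]) auto
qed

lemma (in prob_space) nn_integral_indep_var_le:
  assumes indep: "indep_var S X T Y" and f: "f \<in> borel_measurable (S \<Otimes>\<^sub>M T)"
    and le: "\<And>x. x \<in> space S \<Longrightarrow> (\<integral>\<^sup>+\<omega>. f (x, Y \<omega>) \<partial>M) \<le> C"
  shows "(\<integral>\<^sup>+\<omega>. f (X \<omega>, Y \<omega>) \<partial>M) \<le> C"
proof -
  have X: "X \<in> measurable M S" and Y: "Y \<in> measurable M T"
    using indep by (auto dest: indep_var_rv1 indep_var_rv2)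
  interpret X: prob_space "distr M S X" by (rule prob_space_distr) fact
  interpret Y: prob_space "distr M T Y" by (rule prob_space_distr) fact
  have "(\<integral>\<^sup>+\<omega>. f (X \<omega>, Y \<omega>) \<partial>M) = (\<integral>\<^sup>+z. f z \<partial>distr M (S \<Otimes>\<^sub>M T) (\<lambda>\<omega>. (X \<omega>, Y \<omega>)))"
    using X Y f by (subst nn_integral_distr) auto
  also have "\<dots> = (\<integral>\<^sup>+z. f z \<partial>(distr M S X \<Otimes>\<^sub>M distr M T Y))"
    using indep by (simp add: indep_var_distribution_eq)
  also have "\<dots> = (\<integral>\<^sup>+x. \<integral>\<^sup>+y. f (x, y) \<partial>distr M T Y \<partial>distr M S X)"
    using f by (subst Y.nn_integral_fst) (auto cong: measurable_cong_sets)
  also have "\<dots> \<le> (\<integral>\<^sup>+x. C \<partial>distr M S X)"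
  proof (rule nn_integral_mono)
    fix x assume x: "x \<in> space (distr M S X)"
    then have "(\<lambda>y. f (x, y)) \<in> borel_measurable T"
      using f by (auto intro: measurable_Pair2)
    then show "(\<integral>\<^sup>+y. f (x, y) \<partial>distr M T Y) \<le> C"
      using le[of x] x Y by (simp add: nn_integral_distr)
  qed
  also have "\<dots> = C" using X.emeasure_space_1 by simp
  finally show ?thesis .
qed

text \<open>The error at a fixed point \<open>x\<close>: the bound for independent centred sums is
  applied at level \<open>R = b * \<tau>\<close> and divided by \<open>b\<close>. The assumption
  \<open>batch\<close> is its moment condition at that level.\<close>

lemma nn_integral_minibatch_error_le:
  fixes F :: "'a::euclidean_space \<Rightarrow> real"
  assumes bcm: "p_BCM_oracle p \<sigma> F D G" and iid: "iid_samples M D \<xi> I"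
    and J: "{t} \<times> {1..B t} \<subseteq> I" and B: "1 \<le> B t" and p: "1 \<le> p" "p \<le> 2" and \<tau>: "0 < \<tau>"
    and batch: "real (B t) * \<sigma> powr p \<le> (real (B t) * \<tau>) powr p"
  shows "(\<integral>\<^sup>+\<omega>. norm (minibatch_grad G \<xi> B t x \<omega> - grad F x) \<partial>M) \<le> ennreal (17 / 8 * \<tau>)"
proof -
  interpret prob_space M using iid by (simp add: iid_samples_def)
  interpret D: prob_space D using bcm by (simp add: p_BCM_oracle_def)
  define J where "J = {t} \<times> {1..B t}"
  define b where "b = real (B t)"
  have b: "0 < b" using B by (simp add: b_def)
  define X where "X = (\<lambda>i \<omega>. G x (\<xi> i \<omega>) - grad F x)"
  have intG: "integrable D (G x)" and meanG: "(\<integral>s. G x s \<partial>D) = grad F x"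
    and intGp: "integrable D (\<lambda>s. norm (G x s - grad F x) powr p)"
    and momG: "(\<integral>s. norm (G x s - grad F x) powr p \<partial>D) \<le> \<sigma> powr p"
    using bcm by (auto simp: p_BCM_oracle_def)
  have Gx[measurable]: "G x \<in> borel_measurable D" using intG by auto
  have indep: "indep_vars (\<lambda>_. D) \<xi> J"
    using iid J by (auto simp: iid_samples_def J_def intro: indep_vars_subset)
  have \<xi>[measurable]: "\<xi> i \<in> measurable M D" if "i \<in> J" for i
    using indep that by (auto simp: indep_vars_def)
  have distr: "distr M D (\<xi> i) = D" if "i \<in> J" for i
    using iid J that by (auto simp: iid_samples_def J_def)
  \<comment> \<open>Every sample has law \<open>D\<close>, so moments of the oracle under
    \<open>D\<close> carry over to \<open>M\<close>.\<close>
  have integrable_iff: "integrable M (\<lambda>\<omega>. f (\<xi> i \<omega>)) \<longleftrightarrow> integrable D f"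
    if "i \<in> J" "f \<in> borel_measurable D" for i and f :: "_ \<Rightarrow> 'z::{banach, second_countable_topology}"
    using integrable_distr_eq[OF \<xi>[OF that(1)] that(2)] distr[OF that(1)] by simp
  have integral_eq: "expectation (\<lambda>\<omega>. f (\<xi> i \<omega>)) = integral\<^sup>L D f"
    if "i \<in> J" "f \<in> borel_measurable D" for i and f :: "_ \<Rightarrow> 'z::{banach, second_countable_topology}"
    using integral_distr[OF \<xi>[OF that(1)] that(2)] distr[OF that(1)] by simp
  have indepX: "indep_vars (\<lambda>_. borel) X J"
    unfolding X_def by (rule indep_vars_compose2[OF indep]) measurable
  have intX: "integrable M (X i)" if "i \<in> J" for i
    unfolding X_def using that intG by (subst integrable_iff) auto
  have meanX: "expectation (X i) = 0" if "i \<in> J" for i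
    unfolding X_def using that intG
    by (subst integral_eq[of i "\<lambda>s. G x s - grad F x"]) (auto simp: meanG D.prob_space)
  have intXp: "integrable M (\<lambda>\<omega>. norm (X i \<omega>) powr p)" if "i \<in> J" for i
    unfolding X_def using that intGp
    by (subst integrable_iff[of i "\<lambda>s. norm (G x s - grad F x) powr p"]) auto
  have momX: "expectation (\<lambda>\<omega>. norm (X i \<omega>) powr p) \<le> \<sigma> powr p" if "i \<in> J" for i
    unfolding X_def using that momG
    by (subst integral_eq[of i "\<lambda>s. norm (G x s - grad F x) powr p"]) auto
  have "(\<Sum>i\<in>J. expectation (\<lambda>\<omega>. norm (X i \<omega>) powr p)) \<le> real (card J) * \<sigma> powr p"
    using momX by (rule sum_bounded_above)
  also have "\<dots> \<le> (b * \<tau>) powr p"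
    using batch by (simp add: J_def b_def card_cartesian_product)
  finally have sum_mom: "(\<Sum>i\<in>J. expectation (\<lambda>\<omega>. norm (X i \<omega>) powr p)) \<le> (b * \<tau>) powr p" .
  have finJ: "finite J" by (simp add: J_def)
  have noise: "expectation (\<lambda>\<omega>. norm (\<Sum>i\<in>J. X i \<omega>)) \<le> 17 / 8 * (b * \<tau>)"
    using b \<tau> by (intro expectation_norm_sum_le[OF finJ indepX p _ intX meanX intXp sum_mom]) auto
  have eq: "minibatch_grad G \<xi> B t x \<omega> - grad F x = (1 / b) *\<^sub>R (\<Sum>i\<in>J. X i \<omega>)" for \<omega>
  proof -
    have "(\<Sum>i\<in>J. X i \<omega>) = (\<Sum>j=1..B t. X (t, j) \<omega>)"
      by (rule sum.reindex_bij_witness[of _ "\<lambda>j. (t, j)" snd]) (auto simp: J_def)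
    also have "\<dots> = (\<Sum>j=1..B t. G x (\<xi> (t, j) \<omega>)) - b *\<^sub>R grad F x"
      by (simp add: X_def sum_subtractf b_def sum_constant_scaleR)
    finally show ?thesis
      using b by (simp add: minibatch_grad_def b_def[symmetric] scaleR_diff_right)
  qed
  have "(\<integral>\<^sup>+\<omega>. norm (minibatch_grad G \<xi> B t x \<omega> - grad F x) \<partial>M)
      = ennreal (expectation (\<lambda>\<omega>. norm ((1 / b) *\<^sub>R (\<Sum>i\<in>J. X i \<omega>))))"
    unfolding eq by (intro nn_integral_eq_integral integrable_norm integrable_scaleR_right
        Bochner_Integration.integrable_sum intX) auto
  also have "expectation (\<lambda>\<omega>. norm ((1 / b) *\<^sub>R (\<Sum>i\<in>J. X i \<omega>)))
      = (1 / b) * expectation (\<lambda>\<omega>. norm (\<Sum>i\<in>J. X i \<omega>))"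
    using b by simp
  also have "ennreal \<dots> \<le> ennreal (17 / 8 * \<tau>)"
    using noise b by (intro ennreal_leI) (simp add: field_simps)
  finally show ?thesis .
qed

text \<open>Freezing the past \<open>w\<close> turns the iterate into a fixed point, where the
  preceding bound holds with the same constant; independence of the current batch then allows
  averaging over \<open>w\<close>.\<close>

lemma nn_integral_nsgd_error_le:
  fixes F :: "'a::euclidean_space \<Rightarrow> real" and x1 :: 'a and \<eta> :: "nat \<Rightarrow> real"
  assumes smooth: "L_smooth L F"
    and bcm: "p_BCM_oracle p \<sigma> F D G" and iid: "iid_samples M D \<xi> (SIGMA t:{1..T}. {1..B t})"
    and t: "1 \<le> t" "t \<le> T" and B: "1 \<le> B t" and p: "1 \<le> p" "p \<le> 2" and \<tau>: "0 < \<tau>"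
    and batch: "real (B t) * \<sigma> powr p \<le> (real (B t) * \<tau>) powr p"
  defines "X \<equiv> nsgd G \<xi> \<eta> B x1 t"
  shows "(\<integral>\<^sup>+\<omega>. norm (minibatch_grad G \<xi> B t (X \<omega>) \<omega> - grad F (X \<omega>)) \<partial>M) \<le> ennreal (17 / 8 * \<tau>)"
proof -
  interpret prob_space M using iid by (simp add: iid_samples_def)
  have G: "(\<lambda>(x, s). G x s) \<in> borel_measurable (borel \<Otimes>\<^sub>M D)"
    using bcm by (simp add: p_BCM_oracle_def)
  have grad[measurable]: "grad F \<in> borel_measurable borel"
    using smooth by (intro borel_measurable_continuous_onI L_smooth_continuous_on_grad)
  \<comment> \<open>The range stops before \<open>t\<close>, which makes \<open>P\<close> disjoint
    from the current batch \<open>J\<close>.\<close>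
  define P where "P = (SIGMA s:{1..<t}. {1..B s})"
  define J where "J = {t} \<times> {1..B t}"
  \<comment> \<open>Run on the coordinate maps \<open>?\<pi>\<close>, the algorithm exhibits its iterate as a measurable function
    of the samples in \<open>P\<close>, which are independent of the current batch \<open>J\<close>.\<close>
  let ?\<pi> = "\<lambda>i z. z i"
  define f where "f = (\<lambda>(w, z). ennreal (norm
    (minibatch_grad G ?\<pi> B t (nsgd G ?\<pi> \<eta> B x1 t w) z - grad F (nsgd G ?\<pi> \<eta> B x1 t w))))"
  have sub: "P \<inter> J = {}" "P \<subseteq> (SIGMA t:{1..T}. {1..B t})" "J \<subseteq> (SIGMA t:{1..T}. {1..B t})"
    using t by (auto simp: P_def J_def)
  have indep: "indep_var (PiM P (\<lambda>_. D)) (\<lambda>\<omega>. \<lambda>i\<in>P. \<xi> i \<omega>) (PiM J (\<lambda>_. D)) (\<lambda>\<omega>. \<lambda>i\<in>J. \<xi> i \<omega>)"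
    using iid sub by (intro indep_var_restrict) (auto simp: iid_samples_def)
  have past: "X \<omega> = nsgd G ?\<pi> \<eta> B x1 t (\<lambda>i\<in>P. \<xi> i \<omega>)" for \<omega>
    unfolding X_def by (rule nsgd_cong) (auto simp: P_def)
  have present: "minibatch_grad G \<xi> B t x \<omega> = minibatch_grad G ?\<pi> B t x (\<lambda>i\<in>J. \<xi> i \<omega>)" for x \<omega>
    by (rule minibatch_grad_cong) (auto simp: J_def)
  have meas_past[measurable]: "nsgd G ?\<pi> \<eta> B x1 t \<in> borel_measurable (PiM P (\<lambda>_. D))"
    by (intro borel_measurable_nsgd[OF G] measurable_component_singleton) (auto simp: P_def)
  have meas_present: "(\<lambda>y. minibatch_grad G ?\<pi> B t (nsgd G ?\<pi> \<eta> B x1 t (fst y)) (snd y))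
      \<in> borel_measurable (PiM P (\<lambda>_. D) \<Otimes>\<^sub>M PiM J (\<lambda>_. D))"
    by (intro borel_measurable_minibatch_grad[OF G, where Z=snd]
        measurable_compose[OF measurable_snd measurable_component_singleton]
        measurable_compose[OF measurable_fst meas_past]) (auto simp: J_def)
  have "f \<in> borel_measurable (PiM P (\<lambda>_. D) \<Otimes>\<^sub>M PiM J (\<lambda>_. D))"
    unfolding f_def case_prod_beta using meas_present by measurable
  then have "(\<integral>\<^sup>+\<omega>. f (\<lambda>i\<in>P. \<xi> i \<omega>, \<lambda>i\<in>J. \<xi> i \<omega>) \<partial>M) \<le> ennreal (17 / 8 * \<tau>)"
  proof (rule nn_integral_indep_var_le[OF indep])
    fix w
    show "(\<integral>\<^sup>+\<omega>. f (w, \<lambda>i\<in>J. \<xi> i \<omega>) \<partial>M) \<le> ennreal (17 / 8 * \<tau>)"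
      using nn_integral_minibatch_error_le[where B=B and t=t and x="nsgd G ?\<pi> \<eta> B x1 t w",
          OF bcm iid _ B p \<tau> batch] sub(3)[unfolded J_def]
      by (simp add: f_def present[symmetric])
  qed
  then show ?thesis
    by (simp add: f_def past[symmetric] present[symmetric])
qed

text \<open>Taking expectations in the one-step inequality and telescoping. After division by
  \<open>h * T\<close>, the three terms come from the initial gap, twice the gradient error, and the
  curvature.\<close>

lemma nsgd_avg_grad_norm_le:
  fixes F :: "'a::euclidean_space \<Rightarrow> real"
  assumes setting: "nsgd_setting p \<Delta>1 L \<sigma> T B F Fstar x1 D G M \<xi>"
    and L: "0 \<le> L" and T: "1 \<le> T" and h: "0 < h" and p: "1 \<le> p" "p \<le> 2" and \<tau>: "0 < \<tau>"
    and B: "\<And>t. 1 \<le> t \<Longrightarrow> t \<le> T \<Longrightarrow> 1 \<le> B t"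
    and batch: "\<And>t. 1 \<le> t \<Longrightarrow> t \<le> T \<Longrightarrow> real (B t) * \<sigma> powr p \<le> (real (B t) * \<tau>) powr p"
  shows "avg_grad_norm M F (nsgd G \<xi> (\<lambda>_. h) B x1) T \<le> \<Delta>1 / (h * real T) + 17 / 4 * \<tau> + L * h / 2"
proof -
  have lower: "Fstar \<le> F x" and gap: "F x1 - Fstar \<le> \<Delta>1" and smooth: "L_smooth L F"
    and bcm: "p_BCM_oracle p \<sigma> F D G" and iid: "iid_samples M D \<xi> (SIGMA t:{1..T}. {1..B t})" for x
    using setting by (auto simp: nsgd_setting_def)
  interpret prob_space M using iid by (simp add: iid_samples_def)
  have G: "(\<lambda>(x, s). G x s) \<in> borel_measurable (borel \<Otimes>\<^sub>M D)"
    using bcm by (simp add: p_BCM_oracle_def)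
  have grad[measurable]: "grad F \<in> borel_measurable borel"
    using smooth by (intro borel_measurable_continuous_onI L_smooth_continuous_on_grad)
  define X where "X = nsgd G \<xi> (\<lambda>_. h) B x1"
  define err where "err t \<omega> = norm (minibatch_grad G \<xi> B t (X t \<omega>) \<omega> - grad F (X t \<omega>))" for t \<omega>
  have \<xi>: "\<xi> (s, j) \<in> measurable M D" if "1 \<le> s" "s \<le> T" "1 \<le> j" "j \<le> B s" for s j
    using iid that by (auto simp: iid_samples_def indep_vars_def)
  \<comment> \<open>The range includes \<open>Suc T\<close>, since the telescoping sum ends at the
    point reached after the last step.\<close>
  have X_meas[measurable]: "X t \<in> borel_measurable M" if "t \<le> Suc T" for t
    unfolding X_def using that \<xi> by (intro borel_measurable_nsgd[OF G]) auto
  have intF: "integrable M (\<lambda>\<omega>. F (X t \<omega>))" if "t \<le> Suc T" for t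
    using integrable_continuous_nsgd[OF X_meas[OF that, unfolded X_def] L_smooth_continuous_on[OF smooth]]
    by (simp add: X_def)
  have intgrad: "integrable M (\<lambda>\<omega>. norm (grad F (X t \<omega>)))" if "t \<le> Suc T" for t
    using integrable_continuous_nsgd[OF X_meas[OF that, unfolded X_def]
        continuous_on_norm[OF L_smooth_continuous_on_grad[OF smooth]]]
    by (simp add: X_def)
  have interr: "integrable M (err t)" and err: "expectation (err t) \<le> 17 / 8 * \<tau>"
    if t: "1 \<le> t" "t \<le> T" for t
  proof -
    have Xt[measurable]: "X t \<in> borel_measurable M"
      using t by (intro X_meas) auto
    have [measurable]: "(\<lambda>\<omega>. minibatch_grad G \<xi> B t (X t \<omega>) \<omega>) \<in> borel_measurable M"
      using t \<xi> by (intro borel_measurable_minibatch_grad[OF G _ Xt, where Z="\<lambda>\<omega>. \<omega>"]) auto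
    have meas: "err t \<in> borel_measurable M"
      unfolding err_def by measurable
    have le: "(\<integral>\<^sup>+\<omega>. err t \<omega> \<partial>M) \<le> ennreal (17 / 8 * \<tau>)"
      unfolding err_def X_def
      by (rule nn_integral_nsgd_error_le[OF smooth bcm iid t B[OF t] p \<tau> batch[OF t]])
    have err_nonneg: "norm (err t \<omega>) = err t \<omega>" "0 \<le> err t \<omega>" for \<omega>
      by (simp_all add: err_def)
    \<comment> \<open>The finite nonnegative integral supplies integrability; only then does it
      equal the Bochner expectation.\<close>
    show int: "integrable M (err t)"
      using le meas by (intro integrableI_bounded) (auto simp: err_nonneg intro: le_less_trans)
    show "expectation (err t) \<le> 17 / 8 * \<tau>"
      using le \<tau> by (simp add: nn_integral_eq_integral[OF int] err_nonneg)
  qed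
  have step: "h * expectation (\<lambda>\<omega>. norm (grad F (X t \<omega>)))
      \<le> expectation (\<lambda>\<omega>. F (X t \<omega>)) - expectation (\<lambda>\<omega>. F (X (Suc t) \<omega>))
        + 2 * h * (17 / 8 * \<tau>) + L / 2 * h\<^sup>2" if t: "1 \<le> t" "t \<le> T" for t
  proof -
    have ints: "integrable M (\<lambda>\<omega>. F (X t \<omega>))" "integrable M (\<lambda>\<omega>. F (X (Suc t) \<omega>))"
      "integrable M (err t)" "integrable M (\<lambda>\<omega>. norm (grad F (X t \<omega>)))"
      using t intF intgrad interr by auto
    have "h * expectation (\<lambda>\<omega>. norm (grad F (X t \<omega>)))
        = expectation (\<lambda>\<omega>. h * norm (grad F (X t \<omega>)))" by simp
    also have "\<dots> \<le> expectation (\<lambda>\<omega>. F (X t \<omega>) - F (X (Suc t) \<omega>) + 2 * h * err t \<omega> + L / 2 * h\<^sup>2)"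
    proof (rule integral_mono)
      show "h * norm (grad F (X t \<omega>)) \<le> F (X t \<omega>) - F (X (Suc t) \<omega>) + 2 * h * err t \<omega> + L / 2 * h\<^sup>2" for \<omega>
        using normalized_step_descent[OF smooth L less_imp_le[OF h]] t
        by (simp add: X_def err_def nsgd_Suc)
    qed (use ints in auto)
    also have "\<dots> = expectation (\<lambda>\<omega>. F (X t \<omega>)) - expectation (\<lambda>\<omega>. F (X (Suc t) \<omega>))
        + 2 * h * expectation (err t) + L / 2 * h\<^sup>2"
      using ints by (simp add: prob_space)
    also have "\<dots> \<le> expectation (\<lambda>\<omega>. F (X t \<omega>)) - expectation (\<lambda>\<omega>. F (X (Suc t) \<omega>))
        + 2 * h * (17 / 8 * \<tau>) + L / 2 * h\<^sup>2"
      using mult_left_mono[OF err[OF t], of "2 * h"] h by simp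
    finally show ?thesis .
  qed
  have "h * (\<Sum>t=1..T. expectation (\<lambda>\<omega>. norm (grad F (X t \<omega>))))
      \<le> (\<Sum>t=1..T. (expectation (\<lambda>\<omega>. F (X t \<omega>)) - expectation (\<lambda>\<omega>. F (X (Suc t) \<omega>)))
        + (2 * h * (17 / 8 * \<tau>) + L / 2 * h\<^sup>2))"
    unfolding sum_distrib_left by (intro sum_mono) (use step in \<open>auto simp: algebra_simps\<close>)
  also have "\<dots> = expectation (\<lambda>\<omega>. F (X 1 \<omega>)) - expectation (\<lambda>\<omega>. F (X (Suc T) \<omega>))
      + real T * (2 * h * (17 / 8 * \<tau>) + L / 2 * h\<^sup>2)"
    \<comment> \<open>\<open>sum_Suc_diff\<close> collapses \<open>f (Suc t) - f t\<close>, hence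
      the minus sign in \<open>f\<close>.\<close>
    using sum_Suc_diff[of 1 T "\<lambda>t. - expectation (\<lambda>\<omega>. F (X t \<omega>))"] T
    by (simp add: sum.distrib)
  also have "\<dots> \<le> \<Delta>1 + real T * (2 * h * (17 / 8 * \<tau>) + L / 2 * h\<^sup>2)"
  proof -
    have "Fstar = expectation (\<lambda>\<omega>. Fstar)" by (simp add: prob_space)
    also have "\<dots> \<le> expectation (\<lambda>\<omega>. F (X (Suc T) \<omega>))"
      using intF lower by (intro integral_mono) auto
    finally show ?thesis using gap by (simp add: X_def prob_space)
  qed
  finally have "h * (\<Sum>t=1..T. expectation (\<lambda>\<omega>. norm (grad F (X t \<omega>))))
      \<le> \<Delta>1 + real T * (2 * h * (17 / 8 * \<tau>) + L / 2 * h\<^sup>2)" .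
  then have "(\<Sum>t=1..T. expectation (\<lambda>\<omega>. norm (grad F (X t \<omega>))))
      \<le> (\<Delta>1 + real T * (2 * h * (17 / 8 * \<tau>) + L / 2 * h\<^sup>2)) / h"
    using h by (simp add: pos_le_divide_eq mult.commute)
  from divide_right_mono[OF this, of "real T"]
  have "avg_grad_norm M F X T \<le> (\<Delta>1 + real T * (2 * h * (17 / 8 * \<tau>) + L / 2 * h\<^sup>2)) / h / real T"
    by (simp add: avg_grad_norm_def)
  also have "\<dots> = \<Delta>1 / (h * real T) + 17 / 4 * \<tau> + L * h / 2"
    using h T by (simp add: field_simps power2_eq_square)
  finally show ?thesis by (simp add: X_def)
qed

subsection \<open>Batch size and sample complexity\<close>

lemma batch_size_ge_1: "1 \<le> batch_size p \<Delta>1 L \<sigma> T t"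
  by (simp add: batch_size_def) linarith

lemma batch_size_bounds:
  fixes p \<Delta>1 L \<sigma> :: real and T t :: nat
  defines "u \<equiv> (\<sigma>\<^sup>2 * real T / (\<Delta>1 * L)) powr (p / (2 * p - 2))"
  shows "u \<le> real (batch_size p \<Delta>1 L \<sigma> T t)" and "real (batch_size p \<Delta>1 L \<sigma> T t) \<le> 1 + u"
proof -
  have u: "0 \<le> u" by (simp add: u_def)
  have B: "real (batch_size p \<Delta>1 L \<sigma> T t) = of_int \<lceil>max 1 u\<rceil>"
    unfolding batch_size_def u_def[symmetric] by (intro of_nat_nat) linarith
  show "u \<le> real (batch_size p \<Delta>1 L \<sigma> T t)"
    unfolding B by linarith
  \<comment> \<open>For \<open>u <= 1\<close> the ceiling is exactly 1; rounding up costs something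
    only for \<open>u > 1\<close>, where it costs at most 1.\<close>
  show "real (batch_size p \<Delta>1 L \<sigma> T t) \<le> 1 + u"
    unfolding B using u by (cases "u \<le> 1") (simp_all add: max_def, linarith)
qed

text \<open>The exponent in the batch size is half of \<open>p / (p - 1)\<close>; the square
  compensates.\<close>

lemma powr_square_half_exponent:
  fixes p x :: real
  assumes "1 < p" "0 \<le> x"
  shows "(x\<^sup>2) powr (p / (2 * p - 2)) = x powr (p / (p - 1))"
proof (cases "x = 0")
  case False
  have "(x\<^sup>2) powr (p / (2 * p - 2)) = (x powr 2) powr (p / (2 * p - 2))"
    using assms False by simp
  also have "\<dots> = x powr (2 * (p / (2 * p - 2)))"
    by (rule powr_powr)
  also have "2 * (p / (2 * p - 2)) = p / (p - 1)"
    using assms by (simp add: field_simps)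
  finally show ?thesis .
qed (use assms in simp)

text \<open>Dividing by \<open>b * \<tau> powr p\<close> reduces the claim to
  \<open>(\<sigma> / \<tau>) powr p \<le> b powr (p - 1)\<close>. The quantity raised to a power in
  the batch size is \<open>(\<sigma> / \<tau>)^2\<close>, so \<open>b\<close> is at least
  \<open>(\<sigma> / \<tau>) powr (p / (p - 1))\<close>.\<close>

lemma batch_size_sufficient:
  fixes p \<Delta>1 L \<sigma> :: real and T t :: nat
  assumes p: "1 < p" and pos: "0 < \<Delta>1" "0 < L" "1 \<le> T" and \<sigma>: "0 \<le> \<sigma>"
  defines "\<tau> \<equiv> sqrt (\<Delta>1 * L) / sqrt (real T)" and "b \<equiv> real (batch_size p \<Delta>1 L \<sigma> T t)"
  shows "b * \<sigma> powr p \<le> (b * \<tau>) powr p"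
proof -
  have b: "0 < b" using batch_size_ge_1[of p \<Delta>1 L \<sigma> T t] by (simp add: b_def)
  have \<tau>: "0 < \<tau>" using pos by (simp add: \<tau>_def)
  have "\<sigma>\<^sup>2 * real T / (\<Delta>1 * L) = (\<sigma> / \<tau>)\<^sup>2"
    using pos by (simp add: \<tau>_def power_divide power_mult_distrib)
  then have "(\<sigma>\<^sup>2 * real T / (\<Delta>1 * L)) powr (p / (2 * p - 2)) = (\<sigma> / \<tau>) powr (p / (p - 1))"
    using powr_square_half_exponent[OF p, of "\<sigma> / \<tau>"] \<sigma> \<tau> by simp
  then have "(\<sigma> / \<tau>) powr (p / (p - 1)) \<le> b"
    using batch_size_bounds(1)[of \<sigma> T \<Delta>1 L p t] by (simp add: b_def)
  then have "((\<sigma> / \<tau>) powr (p / (p - 1))) powr (p - 1) \<le> b powr (p - 1)"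
    using p by (intro powr_mono2) auto
  then have "(\<sigma> / \<tau>) powr p \<le> b powr (p - 1)"
    using p by (simp add: powr_powr)
  then have "\<sigma> powr p \<le> b powr (p - 1) * \<tau> powr p"
    using \<sigma> \<tau> by (simp add: powr_divide pos_divide_le_eq)
  then have "b * \<sigma> powr p \<le> b * (b powr (p - 1) * \<tau> powr p)"
    using b by (intro mult_left_mono) auto
  also have "\<dots> = (b * \<tau>) powr p"
    using b \<tau> by (simp add: powr_mult powr_diff)
  finally show ?thesis .
qed

text \<open>This step size gives \<open>\<Delta>1 / (h * T) = L * h = \<tau>\<close>, so the general
  bound becomes \<open>(23 / 4) * \<tau>\<close>.\<close>

lemma nsgd_convergence_rate:
  fixes F :: "'a::euclidean_space \<Rightarrow> real"
  assumes "1 < p" "p \<le> 2" "0 < \<Delta>1" "0 < L" "0 \<le> \<sigma>" "1 \<le> T"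
    and setting: "nsgd_setting p \<Delta>1 L \<sigma> T (batch_size p \<Delta>1 L \<sigma> T) F Fstar x1 D G M \<xi>"
  shows "avg_grad_norm M F (nsgd G \<xi> (step_size \<Delta>1 L T) (batch_size p \<Delta>1 L \<sigma> T) x1) T
    \<le> 6 * (sqrt (\<Delta>1 * L) / sqrt (real T))"
proof -
  define \<tau> where "\<tau> = sqrt (\<Delta>1 * L) / sqrt (real T)"
  define h where "h = sqrt (\<Delta>1 / (L * real T))"
  have \<tau>: "0 < \<tau>" and h: "0 < h" using assms by (auto simp: \<tau>_def h_def)
  have Lh: "L * h = \<tau>"
  proof -
    have "L * h = sqrt (L\<^sup>2 * (\<Delta>1 / (L * real T)))"
      using assms by (simp add: h_def real_sqrt_mult real_sqrt_divide)
    also have "\<dots> = \<tau>"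
      using assms by (simp add: \<tau>_def real_sqrt_divide[symmetric] power2_eq_square field_simps)
    finally show ?thesis .
  qed
  have "h * h = \<Delta>1 / (L * real T)"
    using assms by (simp add: h_def)
  then have "\<Delta>1 / (h * real T) = \<tau>"
    using h assms by (simp add: Lh[symmetric] field_simps)
  moreover have "avg_grad_norm M F (nsgd G \<xi> (\<lambda>_. h) (batch_size p \<Delta>1 L \<sigma> T) x1) T
      \<le> \<Delta>1 / (h * real T) + 17 / 4 * \<tau> + L * h / 2"
    using assms h \<tau> batch_size_ge_1 batch_size_sufficient[OF assms(1,3,4,6,5)]
    by (intro nsgd_avg_grad_norm_le[OF setting]) (auto simp: \<tau>_def)
  ultimately show ?thesis
    using Lh \<tau> by (simp add: step_size_def h_def[symmetric] \<tau>_def[symmetric])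
qed

lemma sample_complexity_bound:
  fixes p \<Delta>1 L \<sigma> \<epsilon> :: real
  assumes p: "1 < p" and pos: "0 < \<Delta>1" "0 < L" "0 < \<epsilon>" and \<sigma>: "0 \<le> \<sigma>"
    and T: "real T \<le> 37 * (\<Delta>1 * L / \<epsilon>\<^sup>2)"
  shows "real (\<Sum>t=1..T. batch_size p \<Delta>1 L \<sigma> T t)
    \<le> complexity_const p *
      (\<Delta>1 * L / \<epsilon>\<^sup>2 + \<Delta>1 * L / \<epsilon>\<^sup>2 * (\<sigma> / \<epsilon>) powr (p / (p - 1)))"
proof -
  define q where "q = p / (2 * p - 2)"
  define A where "A = \<Delta>1 * L / \<epsilon>\<^sup>2"
  define v where "v = (\<sigma> / \<epsilon>) powr (p / (p - 1))"
  have q: "0 < q" using p by (simp add: q_def)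
  have A: "0 < A" using pos by (simp add: A_def)
  have v: "0 \<le> v" by (simp add: v_def)
  have "\<sigma>\<^sup>2 * real T / (\<Delta>1 * L) \<le> \<sigma>\<^sup>2 * (37 * A) / (\<Delta>1 * L)"
    using T pos by (intro divide_right_mono mult_left_mono) (auto simp: A_def)
  also have "\<dots> = 37 * (\<sigma> / \<epsilon>)\<^sup>2"
    using pos by (simp add: A_def power_divide)
  finally have "(\<sigma>\<^sup>2 * real T / (\<Delta>1 * L)) powr q \<le> (37 * (\<sigma> / \<epsilon>)\<^sup>2) powr q"
    using q pos by (intro powr_mono2) auto
  also have "\<dots> = 37 powr q * ((\<sigma> / \<epsilon>)\<^sup>2) powr q"
    by (simp add: powr_mult)
  also have "((\<sigma> / \<epsilon>)\<^sup>2) powr q = v"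
    using powr_square_half_exponent[OF p, of "\<sigma> / \<epsilon>"] \<sigma> pos unfolding v_def q_def by simp
  finally have "real (batch_size p \<Delta>1 L \<sigma> T t) \<le> 1 + 37 powr q * v" for t
    using batch_size_bounds(2)[of p \<Delta>1 L \<sigma> T t] by (simp add: q_def)
  then have "(\<Sum>t=1..T. real (batch_size p \<Delta>1 L \<sigma> T t)) \<le> real (card {1..T}) * (1 + 37 powr q * v)"
    by (intro sum_bounded_above)
  also have "\<dots> \<le> (37 * A) * (1 + 37 powr q * v)"
    using T v by (intro mult_right_mono) (auto simp: A_def)
  \<comment> \<open>As \<open>q > 0\<close>, the factor \<open>37 powr q\<close> is at least 1 and
    also absorbs the summand 1; together with \<open>37 * A\<close> it yields
    \<open>complexity_const p\<close>.\<close>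
  also have "\<dots> \<le> (37 * A) * (37 powr q * (1 + v))"
    using A q by (intro mult_left_mono) (auto simp: distrib_left ge_one_powr_ge_zero)
  also have "\<dots> = complexity_const p * (A + A * v)"
    unfolding complexity_const_def q_def[symmetric] by (simp add: powr_add algebra_simps)
  finally show ?thesis by (simp add: A_def v_def)
qed

theorem corollary3:
  fixes p \<Delta>1 L \<sigma> :: real
  assumes "1 < p" and "p \<le> 2" and "\<Delta>1 > 0" and "L > 0" and "\<sigma> \<ge> 0"
  shows
    "(\<forall>T\<ge>1. \<forall>(F :: real ^ 'd \<Rightarrow> real) Fstar x1 (D :: 's measure) G (M :: 'w measure) \<xi>.
        nsgd_setting p \<Delta>1 L \<sigma> T (batch_size p \<Delta>1 L \<sigma> T) F Fstar x1 D G M \<xi> \<longrightarrow>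
        avg_grad_norm M F (nsgd G \<xi> (step_size \<Delta>1 L T) (batch_size p \<Delta>1 L \<sigma> T) x1) T
          \<le> 6 * (sqrt (\<Delta>1 * L) / sqrt (real T)))
     \<and>
     (\<forall>\<epsilon>. 0 < \<epsilon> \<and> \<epsilon> \<le> sqrt (\<Delta>1 * L) \<longrightarrow>
        (\<exists>T\<ge>1.
          real (\<Sum>t=1..T. batch_size p \<Delta>1 L \<sigma> T t)
            \<le> complexity_const p *
                (\<Delta>1 * L / \<epsilon>\<^sup>2 + \<Delta>1 * L / \<epsilon>\<^sup>2 * (\<sigma> / \<epsilon>) powr (p / (p - 1))) \<and>
          (\<forall>(F :: real ^ 'd \<Rightarrow> real) Fstar x1 (D :: 's measure) G (M :: 'w measure) \<xi>.
             nsgd_setting p \<Delta>1 L \<sigma> T (batch_size p \<Delta>1 L \<sigma> T) F Fstar x1 D G M \<xi> \<longrightarrow>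
             avg_grad_norm M F (nsgd G \<xi> (step_size \<Delta>1 L T) (batch_size p \<Delta>1 L \<sigma> T) x1) T
               \<le> \<epsilon>)))"
proof (intro conjI allI impI)
  fix \<epsilon> :: real
  assume "0 < \<epsilon> \<and> \<epsilon> \<le> sqrt (\<Delta>1 * L)"
  then have \<epsilon>: "0 < \<epsilon>" "\<epsilon> \<le> sqrt (\<Delta>1 * L)" by auto
  define A where "A = \<Delta>1 * L / \<epsilon>\<^sup>2"
  \<comment> \<open>The 36 is the square of the constant 6 in the rate. This \<open>T\<close>
    depends only on \<open>\<Delta>1\<close>, \<open>L\<close> and \<open>\<epsilon>\<close>, so it
    is fixed before the function and the oracle.\<close>
  define T where "T = nat \<lceil>36 * A\<rceil>"
  have "\<epsilon>\<^sup>2 \<le> \<Delta>1 * L"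
    using power_mono[OF \<epsilon>(2), of 2] \<epsilon>(1) assms by simp
  \<comment> \<open>This is where small \<open>\<epsilon>\<close> enters: rounding
    \<open>36 * A\<close> up adds at most \<open>1 \<le> A\<close>, hence the 37.\<close>
  then have A: "1 \<le> A"
    using \<epsilon> by (simp add: A_def le_divide_eq)
  then have T: "1 \<le> T" "36 * A \<le> real T" "real T \<le> 37 * A"
    unfolding T_def by linarith+
  have sq: "(6 * sqrt (\<Delta>1 * L))\<^sup>2 \<le> (\<epsilon> * sqrt (real T))\<^sup>2"
    using T(2) \<epsilon> assms by (simp add: A_def power_mult_distrib field_simps)
  have "6 * sqrt (\<Delta>1 * L) \<le> \<epsilon> * sqrt (real T)"
    by (rule power2_le_imp_le[OF sq]) (use \<epsilon> in simp)
  then have le: "6 * (sqrt (\<Delta>1 * L) / sqrt (real T)) \<le> \<epsilon>"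
    using T(1) by (simp add: pos_divide_le_eq)
  show "\<exists>T\<ge>1.
      real (\<Sum>t=1..T. batch_size p \<Delta>1 L \<sigma> T t)
        \<le> complexity_const p *
            (\<Delta>1 * L / \<epsilon>\<^sup>2 + \<Delta>1 * L / \<epsilon>\<^sup>2 * (\<sigma> / \<epsilon>) powr (p / (p - 1))) \<and>
      (\<forall>(F :: real ^ 'd \<Rightarrow> real) Fstar x1 (D :: 's measure) G (M :: 'w measure) \<xi>.
         nsgd_setting p \<Delta>1 L \<sigma> T (batch_size p \<Delta>1 L \<sigma> T) F Fstar x1 D G M \<xi> \<longrightarrow>
         avg_grad_norm M F (nsgd G \<xi> (step_size \<Delta>1 L T) (batch_size p \<Delta>1 L \<sigma> T) x1) T \<le> \<epsilon>)"
    using T assms \<epsilon>(1) order_trans[OF nsgd_convergence_rate le]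
    by (intro exI[of _ T] conjI allI impI sample_complexity_bound) (auto simp: A_def)
qed (rule nsgd_convergence_rate[OF assms])

end
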